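(* Let $T>0$ and let $X=(X_t)_{t\in[0,T]}$ be a square-integrable process on a complete probability space $(\Omega,\mathcal F,\mathbb P)$, with natural filtration $(\mathcal F^X_t)_{t\in[0,T]}$, energy space $(\mathcal H_X,\delta_X)$, predictable projection $\Pi_X:\mathcal H_X\to\mathcal H_X$, and operator-covariant derivative $D_X=\delta_X^*:L^2(\Omega)\to\mathcal H_X$. Assume: (i) (Centered integrals) $\mathbb E[\delta_X(u)]=0$ for all $u\in\mathcal H_X$. (ii) (Isometry on predictable processes) $\mathbb E[|\delta_X(u)|^2]=\|u\|_{\mathcal H_X}^2$ for all predictable $u\in\mathcal H_X$. (iii) (Representation property) Every $\mathcal F^X_T$-measurable $\tilde F\in L^2(\Omega)$ with $\mathbb E[\tilde F]=0$ can be written as $\tilde F=\delta_X(v)$ for some predictable $v\in\mathcal H_X$. Then for every $\mathcal F^X_T$-measurable $F\in L^2(\Omega)$, $$F=\mathbb E[F]+\delta_X(\Pi_X D_X F).$$ Equivalently, $\mathrm{Id}-\mathbb E=\delta_X\circ\Pi_X\circ D_X$ on $L^2(\Omega,\mathcal F^X_T,\mathbb P)$.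
   Context: $L^2(\Omega)=L^2(\Omega,\mathcal F,\mathbb P)$ denotes real square-integrable random variables. The natural filtration is $\mathcal F^X_t=\sigma(X_s:s\le t)$, augmented to satisfy the usual conditions (completeness and right-continuity). The predictable $\sigma$-algebra on $[0,T]\times\Omega$ is generated by the left-continuous adapted processes. Energy space: a pair $(\mathcal H_X,\delta_X)$ consisting of a real separable Hilbert space $\mathcal H_X$ of (equivalence classes of) processes $u=(u_t)_{t\in[0,T]}$ and a continuous linear operator $\delta_X:\mathcal H_X\to L^2(\Omega)$ (called the stochastic integral or divergence with respect to $X$). Predictable projection: it is assumed that $\mathcal H_X$ consists of jointly measurable processes and that the predictable processes form a closed subspace of $\mathcal H_X$; $\Pi_X$ is the orthogonal projection of $\mathcal H_X$ onto this subspace. Operator-covariant derivative: $D_X:=\delta_X^*$ is the Hilbert space adjoint of $\delta_X$; that is, for $F\in L^2(\Omega)$, $D_XF\in\mathcal H_X$ is the unique element with $\mathbb E[F\,\delta_X(u)]=\langle D_XF,u\rangle_{\mathcal H_X}$ for all $u\in\mathcal H_X$. *)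

theory Defs
  imports "HOL-Probability.Probability"
begin

text \<open>Elements of \<open>L\<^sup>2\<close> are represented by square-integrable random variables; equality in \<open>L\<^sup>2\<close> is
  almost-sure equality.  If \<open>G\<close> is a sub-sigma-algebra of \<open>M\<close> then the \<open>G\<close>-measurable elements are
  \<open>L2 M \<inter> borel_measurable G\<close>.\<close>

definition L2 :: "'w measure \<Rightarrow> ('w \<Rightarrow> real) set" where
  "L2 M = {F \<in> borel_measurable M. integrable M (\<lambda>\<omega>. (F \<omega>)\<^sup>2)}"

definition L2_norm :: "'w measure \<Rightarrow> ('w \<Rightarrow> real) \<Rightarrow> real" where
  "L2_norm M F = sqrt (\<integral>\<omega>. (F \<omega>)\<^sup>2 \<partial>M)"

text \<open>A process indexed by \<open>[0, T]\<close> is a function \<open>real \<Rightarrow> 'w \<Rightarrow> real\<close> whose values outside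
  \<open>{0..T} \<times> space M\<close> are irrelevant.\<close>

definition raw_filtration_sets ::
    "'w measure \<Rightarrow> real \<Rightarrow> (real \<Rightarrow> 'w \<Rightarrow> real) \<Rightarrow> real \<Rightarrow> 'w set set" where
  "raw_filtration_sets M T X t =
     sigma_sets (space M)
       ({X r -` B \<inter> space M | r B. r \<in> {0..min t T} \<and> B \<in> sets borel} \<union> null_sets M)"

text \<open>The raw filtration is completed by the null sets of \<open>M\<close> and then made right-continuous. Since
  it is constant from time \<open>T\<close> on, at \<open>t = T\<close> the intersection is just the completed
  sigma-algebra generated by the whole process. The measure component of the result is not used.\<close>

definition natural_filtration ::
    "'w measure \<Rightarrow> real \<Rightarrow> (real \<Rightarrow> 'w \<Rightarrow> real) \<Rightarrow> real \<Rightarrow> 'w measure" where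
  "natural_filtration M T X t = sigma (space M) (\<Inter>s\<in>{t<..}. raw_filtration_sets M T X s)"

lemma sets_natural_filtration:
  "sets (natural_filtration M T X t) = (\<Inter>s\<in>{t<..}. raw_filtration_sets M T X s)"
proof -
  have gen: "{X r -` B \<inter> space M | r B. r \<in> {0..min s T} \<and> B \<in> sets borel} \<union> null_sets M
      \<subseteq> Pow (space M)" for s
    by (auto dest: sets.sets_into_space)
  have alg: "sigma_algebra (space M) (raw_filtration_sets M T X s)" for s
    unfolding raw_filtration_sets_def by (rule sigma_algebra_sigma_sets[OF gen])
  have "t + 1 \<in> {t<..}" by simp
  then have sub: "(\<Inter>s\<in>{t<..}. raw_filtration_sets M T X s) \<subseteq> Pow (space M)"
    using sigma_algebra_iff2[THEN iffD1, OF alg[of "t + 1"]] by (meson INF_lower2)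
  have "sigma_algebra (space M) (\<Inter>s\<in>{t<..}. raw_filtration_sets M T X s)"
    unfolding sigma_algebra_iff2
  proof (intro conjI ballI allI impI INT_I)
    show "{} \<in> raw_filtration_sets M T X s" for s
      using sigma_algebra_iff2[THEN iffD1, OF alg[of s]] by simp
    show "space M - A \<in> raw_filtration_sets M T X s"
      if "A \<in> (\<Inter>s\<in>{t<..}. raw_filtration_sets M T X s)" "s \<in> {t<..}" for A s
      using sigma_algebra_iff2[THEN iffD1, OF alg[of s]] that by simp
    show "\<Union>(range A) \<in> raw_filtration_sets M T X s"
      if "range A \<subseteq> (\<Inter>s\<in>{t<..}. raw_filtration_sets M T X s)" "s \<in> {t<..}"
      for A :: "nat \<Rightarrow> 'a set" and s
    proof -
      have "range A \<subseteq> raw_filtration_sets M T X s" using that by (meson INF_lower subset_trans)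
      then show ?thesis using sigma_algebra_iff2[THEN iffD1, OF alg[of s]] by simp
    qed
  qed (fact sub)
  then show ?thesis
    unfolding natural_filtration_def
    by (simp only: sets_measure_of[OF sub] sigma_algebra.sigma_sets_eq)
qed

definition left_continuous_adapted ::
    "'w measure \<Rightarrow> real \<Rightarrow> (real \<Rightarrow> 'w measure) \<Rightarrow> (real \<Rightarrow> 'w \<Rightarrow> real) \<Rightarrow> bool" where
  "left_continuous_adapted M T \<F> u \<longleftrightarrow>
     (\<forall>t\<in>{0..T}. u t \<in> borel_measurable (\<F> t)) \<and>
     (\<forall>\<omega>\<in>space M. \<forall>t\<in>{0<..T}. ((\<lambda>s. u s \<omega>) \<longlongrightarrow> u t \<omega>) (at_left t))"

definition predictable_algebra ::
    "'w measure \<Rightarrow> real \<Rightarrow> (real \<Rightarrow> 'w measure) \<Rightarrow> (real \<times> 'w) measure" where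
  "predictable_algebra M T \<F> =
     sigma ({0..T} \<times> space M)
       {(\<lambda>(t, \<omega>). u t \<omega>) -` B \<inter> ({0..T} \<times> space M) | u B.
          left_continuous_adapted M T \<F> u \<and> B \<in> sets borel}"

definition predictable ::
    "'w measure \<Rightarrow> real \<Rightarrow> (real \<Rightarrow> 'w measure) \<Rightarrow> (real \<Rightarrow> 'w \<Rightarrow> real) \<Rightarrow> bool" where
  "predictable M T \<F> u \<longleftrightarrow> (\<lambda>(t, \<omega>). u t \<omega>) \<in> borel_measurable (predictable_algebra M T \<F>)"

text \<open>The Hilbert space of equivalence classes of processes is the type \<open>'h\<close>: \<open>V\<close> is the set of
  (jointly measurable) processes that represent some element, and \<open>cls\<close> sends such a process to its
  class, so that \<open>u, v \<in> V\<close> are identified iff \<open>cls u = cls v\<close>.  Which identification is used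
  (for instance up to \<open>dt \<otimes> \<P>\<close>-null sets) is left open, except that the vector space operations
  are the pointwise ones and values outside \<open>{0..T} \<times> space M\<close> play no role.

  The operator \<open>\<delta>\<close> picks a representative of an element of \<open>L\<^sup>2\<close>, so linearity holds almost surely;
  continuity is expressed as in \<^const>\<open>bounded_linear\<close>.\<close>

locale energy_space =
  fixes M :: "'w measure" and T :: real
    and V :: "(real \<Rightarrow> 'w \<Rightarrow> real) set"
    and cls :: "(real \<Rightarrow> 'w \<Rightarrow> real) \<Rightarrow> 'h :: {real_inner, complete_space}"
    and \<delta> :: "'h \<Rightarrow> 'w \<Rightarrow> real"
  assumes separable: "separable_space (euclidean :: 'h topology)"
    and cls_surj: "cls ` V = UNIV"
    and jointly_measurable:
      "u \<in> V \<Longrightarrow> (\<lambda>(t, \<omega>). u t \<omega>) \<in> borel_measurable (restrict_space borel {0..T} \<Otimes>\<^sub>M M)"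
    and V_cong:
      "\<lbrakk>u \<in> V; \<And>t \<omega>. t \<in> {0..T} \<Longrightarrow> \<omega> \<in> space M \<Longrightarrow> v t \<omega> = u t \<omega>\<rbrakk> \<Longrightarrow> v \<in> V \<and> cls v = cls u"
    and V_add:
      "\<lbrakk>u \<in> V; v \<in> V\<rbrakk> \<Longrightarrow> (\<lambda>t \<omega>. u t \<omega> + v t \<omega>) \<in> V \<and> cls (\<lambda>t \<omega>. u t \<omega> + v t \<omega>) = cls u + cls v"
    and V_scale:
      "u \<in> V \<Longrightarrow> (\<lambda>t \<omega>. c * u t \<omega>) \<in> V \<and> cls (\<lambda>t \<omega>. c * u t \<omega>) = c *\<^sub>R cls u"
    and \<delta>_L2: "\<delta> h \<in> L2 M"
    and \<delta>_add: "AE \<omega> in M. \<delta> (h + k) \<omega> = \<delta> h \<omega> + \<delta> k \<omega>"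
    and \<delta>_scale: "AE \<omega> in M. \<delta> (c *\<^sub>R h) \<omega> = c * \<delta> h \<omega>"
    and \<delta>_bounded: "\<exists>K. \<forall>h. L2_norm M (\<delta> h) \<le> norm h * K"

text \<open>An element of the energy space is predictable if it has a predictable representative.\<close>

definition predictable_elements ::
    "'w measure \<Rightarrow> real \<Rightarrow> (real \<Rightarrow> 'w measure) \<Rightarrow> (real \<Rightarrow> 'w \<Rightarrow> real) set \<Rightarrow>
      ((real \<Rightarrow> 'w \<Rightarrow> real) \<Rightarrow> 'h) \<Rightarrow> 'h set" where
  "predictable_elements M T \<F> V cls = cls ` {u \<in> V. predictable M T \<F> u}"

definition orthogonal_projection :: "'h set \<Rightarrow> 'h \<Rightarrow> 'h :: real_inner" where
  "orthogonal_projection S h = (THE p. p \<in> S \<and> h - p \<in> orthogonal_comp S)"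

text \<open>The Hilbert space adjoint of \<open>\<delta>\<close>; only its values on \<open>L2 M\<close> are meaningful.\<close>

definition covariant_derivative ::
    "'w measure \<Rightarrow> ('h \<Rightarrow> 'w \<Rightarrow> real) \<Rightarrow> ('w \<Rightarrow> real) \<Rightarrow> 'h :: real_inner" where
  "covariant_derivative M \<delta> F = (THE h. \<forall>u. (\<integral>\<omega>. F \<omega> * \<delta> u \<omega> \<partial>M) = inner h u)"

end

theory Submission
  imports Defs
begin

text \<open>For \<open>F\<close> measurable with respect to \<open>\<F> T\<close>, the representation property gives a predictable \<open>v\<close>
  with \<open>F - \<E> F = \<delta> v\<close>.  Polarising the isometry yields, for predictable \<open>u\<close>,
  \<open>\<langle>D F, u\<rangle> = \<E> (F \<delta> u) = \<E> (\<delta> v \<delta> u) = \<langle>v, u\<rangle>\<close>, the constant \<open>\<E> F\<close> dropping out because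
  integrals are centered.  So \<open>v\<close> satisfies the defining property of the projection of \<open>D F\<close>.
  Existence of \<open>D F\<close> is the Riesz representation theorem, proved by minimising
  \<open>\<parallel>h\<parallel>\<^sup>2 - 2 f h\<close>.\<close>

section \<open>Riesz representation of bounded functionals\<close>

lemma riesz_representation:
  fixes f :: "'h :: {real_inner, complete_space} \<Rightarrow> real"
  assumes "bounded_linear f"
  obtains h where "\<And>u. f u = inner h u"
proof -
  interpret f: bounded_linear f by fact
  define J where "J h = (norm h)\<^sup>2 - 2 * f h" for h
  define m where "m = Inf (range J)"
  obtain K where K: "\<And>h. norm (f h) \<le> norm h * K"
    using f.bounded by blast
  \<comment> \<open>Completing the square: \<open>J h\<close> is at least
    \<open>(norm h)\<^sup>2 - 2 * K * norm h\<close>, so the infimum \<open>m\<close> is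
    finite.\<close>
  have "- K\<^sup>2 \<le> J h" for h
  proof -
    have "f h \<le> norm h * K"
      using K[of h] by simp
    moreover have "0 \<le> (norm h - K)\<^sup>2"
      by simp
    ultimately show ?thesis
      unfolding J_def by (simp add: power2_diff)
  qed
  then have "bdd_below (range J)"
    by (rule bdd_belowI2)
  then have m_le: "m \<le> J h" for h
    unfolding m_def by (simp add: cInf_lower)
  have "\<exists>h. J h < m + inverse (real (Suc n))" for n
    using cInf_lessD[of "range J" "m + inverse (real (Suc n))"] unfolding m_def by auto
  then obtain x where x: "\<And>n. J (x n) < m + inverse (real (Suc n))"
    by metis
  \<comment> \<open>Comparing \<open>m\<close> with \<open>J\<close> at the midpoint of
    \<open>h\<close> and \<open>k\<close> and applying the parallelogram law shows that
    near-minimisers lie close together. The minimising sequence \<open>x\<close> is therefore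
    Cauchy.\<close>
  have dist_le: "(norm (h - k))\<^sup>2 \<le> 2 * (J h - m) + 2 * (J k - m)" for h k
  proof -
    have "m \<le> J ((1 / 2) *\<^sub>R (h + k))"
      by (rule m_le)
    also have "\<dots> = (norm (h + k))\<^sup>2 / 4 - (f h + f k)"
      unfolding J_def f.scaleR f.add norm_scaleR by (simp add: power_divide add_divide_distrib)
    finally show ?thesis
      by (simp add: J_def power2_norm_eq_inner inner_add inner_diff inner_commute field_simps)
  qed
  have "Cauchy x"
  proof (rule metric_CauchyI)
    fix e :: real
    assume "0 < e"
    \<comment> \<open>In \<open>dist_le\<close> each of the two excesses over \<open>m\<close> is
      doubled, so a quarter of \<open>e\<^sup>2\<close> for each is enough.\<close>
    then obtain N where N: "inverse (real (Suc N)) < e\<^sup>2 / 4"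
      using reals_Archimedean[of "e\<^sup>2 / 4"] by auto
    have near: "J (x n) - m < e\<^sup>2 / 4" if "n \<ge> N" for n
    proof -
      have "inverse (real (Suc n)) \<le> inverse (real (Suc N))"
        using that by (simp add: le_imp_inverse_le)
      then show ?thesis
        using x[of n] N by linarith
    qed
    have "dist (x i) (x j) < e" if "i \<ge> N" "j \<ge> N" for i j
    proof -
      have "(norm (x i - x j))\<^sup>2 < e\<^sup>2"
        using dist_le[of "x i" "x j"] near[OF that(1)] near[OF that(2)] by simp
      then show ?thesis
        using \<open>0 < e\<close> by (simp add: dist_norm power2_less_imp_less)
    qed
    then show "\<exists>N. \<forall>i\<ge>N. \<forall>j\<ge>N. dist (x i) (x j) < e"
      by blast
  qed
  then obtain h where h: "x \<longlonglongrightarrow> h"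
    using Cauchy_convergent convergent_def by blast
  \<comment> \<open>Continuity of \<open>J\<close> makes the limit \<open>h\<close> an actual
    minimiser.\<close>
  have "(\<lambda>n. J (x n)) \<longlonglongrightarrow> J h"
    unfolding J_def by (intro tendsto_intros f.tendsto h)
  moreover have "(\<lambda>n. m + inverse (real (Suc n))) \<longlonglongrightarrow> m"
    using tendsto_add[OF tendsto_const[of m] LIMSEQ_inverse_real_of_nat] by simp
  ultimately have "J h \<le> m"
    using x by (intro LIMSEQ_le) (auto intro: less_imp_le)
  have "f u = inner h u" for u
  proof (rule ccontr)
    assume "f u \<noteq> inner h u"
    \<comment> \<open>Along the line through \<open>h\<close> in direction \<open>u\<close>,
      \<open>J\<close> is a quadratic whose slope at \<open>h\<close> is \<open>2 * a\<close>. If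
      \<open>a\<close> is nonzero, the step \<open>- a / c\<close> strictly lowers \<open>J\<close>,
      contradicting minimality. The added 1 in \<open>c\<close> keeps the denominator positive even
      when \<open>u\<close> is zero.\<close>
    define a where "a = inner h u - f u"
    define c where "c = (norm u)\<^sup>2 + 1"
    have "a \<noteq> 0"
      using \<open>f u \<noteq> inner h u\<close> by (simp add: a_def)
    have "c > 0"
      by (simp add: c_def add_nonneg_pos)
    have expand: "J (h + t *\<^sub>R u) = J h + 2 * t * a + t\<^sup>2 * (c - 1)" for t
      unfolding J_def a_def c_def power2_norm_eq_inner
      by (simp add: f.add f.scaleR inner_add inner_commute algebra_simps power2_eq_square)
    have "J h \<le> J (h + (- a / c) *\<^sub>R u)"
      using \<open>J h \<le> m\<close> m_le by (rule order_trans)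
    also have "\<dots> = J h - (a\<^sup>2 / c + a\<^sup>2 / c\<^sup>2)"
      unfolding expand using \<open>c > 0\<close> by (simp add: field_simps power2_eq_square)
    also have "\<dots> < J h"
      using \<open>a \<noteq> 0\<close> \<open>c > 0\<close> add_pos_pos[of "a\<^sup>2 / c" "a\<^sup>2 / c\<^sup>2"] by simp
    finally show False
      by simp
  qed
  then show thesis
    by (rule that)
qed

section \<open>Square-integrable functions and the Cauchy-Schwarz inequality\<close>

lemma L2_measurable: "F \<in> L2 M \<Longrightarrow> F \<in> borel_measurable M"
  by (simp add: L2_def)

lemma L2_integrable_square: "F \<in> L2 M \<Longrightarrow> integrable M (\<lambda>\<omega>. (F \<omega>)\<^sup>2)"
  by (simp add: L2_def)

lemma L2_integrable_mult:
  assumes "F \<in> L2 M" "G \<in> L2 M"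
  shows "integrable M (\<lambda>\<omega>. F \<omega> * G \<omega>)"
proof (rule Bochner_Integration.integrable_bound)
  show "integrable M (\<lambda>\<omega>. (F \<omega>)\<^sup>2 + (G \<omega>)\<^sup>2)"
    using assms by (intro Bochner_Integration.integrable_add L2_integrable_square)
  show "(\<lambda>\<omega>. F \<omega> * G \<omega>) \<in> borel_measurable M"
    using assms by (intro borel_measurable_times L2_measurable)
  have "\<bar>a * b\<bar> \<le> \<bar>a\<^sup>2 + b\<^sup>2\<bar>" for a b :: real
    using sum_squares_bound[of "\<bar>a\<bar>" "\<bar>b\<bar>"] abs_ge_zero[of "a * b"]
    unfolding abs_mult power2_abs by linarith
  then show "AE \<omega> in M. norm (F \<omega> * G \<omega>) \<le> norm ((F \<omega>)\<^sup>2 + (G \<omega>)\<^sup>2)"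
    by simp
qed

text \<open>The integral of the square of \<open>F - t * G\<close> is a quadratic in
  \<open>t\<close> that is never negative; evaluating it at a suitable \<open>t\<close> gives the
  bound.\<close>

lemma L2_Cauchy_Schwarz:
  assumes "F \<in> L2 M" "G \<in> L2 M"
  shows "\<bar>\<integral>\<omega>. F \<omega> * G \<omega> \<partial>M\<bar> \<le> L2_norm M F * L2_norm M G"
proof -
  define A where "A = (\<integral>\<omega>. (F \<omega>)\<^sup>2 \<partial>M)"
  define B where "B = (\<integral>\<omega>. F \<omega> * G \<omega> \<partial>M)"
  define C where "C = (\<integral>\<omega>. (G \<omega>)\<^sup>2 \<partial>M)"
  note int [simp] = L2_integrable_square[OF assms(1)] L2_integrable_square[OF assms(2)]
    L2_integrable_mult[OF assms]
  have nonneg: "0 \<le> A - 2 * t * B + t\<^sup>2 * C" for t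
  proof -
    have "0 \<le> (\<integral>\<omega>. (F \<omega> - t * G \<omega>)\<^sup>2 \<partial>M)"
      by simp
    also have "\<dots> = (\<integral>\<omega>. (F \<omega>)\<^sup>2 - 2 * t * (F \<omega> * G \<omega>) + t\<^sup>2 * (G \<omega>)\<^sup>2 \<partial>M)"
      by (rule Bochner_Integration.integral_cong) (simp_all add: power2_diff power_mult_distrib)
    also have "\<dots> = A - 2 * t * B + t\<^sup>2 * C"
      by (simp add: A_def B_def C_def)
    finally show ?thesis .
  qed
  have "B\<^sup>2 \<le> A * C"
  proof (cases "C = 0")
    case True
    have "B = 0"
    proof (rule ccontr)
      assume "B \<noteq> 0"
      then show False
        \<comment> \<open>With \<open>C = 0\<close> the quadratic is affine in \<open>t\<close>, and
          this \<open>t\<close> gives it the value -1.\<close>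
        using nonneg[of "(A + 1) / (2 * B)"] True by simp
    qed
    with True show ?thesis
      by simp
  next
    case False
    then have "C > 0"
      by (simp add: C_def less_le)
    then show ?thesis
      \<comment> \<open>The quadratic attains its minimum at \<open>B / C\<close>.\<close>
      using nonneg[of "B / C"] by (simp add: field_simps power2_eq_square)
  qed
  then have "\<bar>B\<bar> \<le> sqrt (A * C)"
    by (metis real_sqrt_abs real_sqrt_le_mono)
  then show ?thesis
    by (simp add: L2_norm_def A_def B_def C_def real_sqrt_mult)
qed

section \<open>The adjoint of the divergence and the polarised isometry\<close>

context energy_space
begin

lemmas \<delta>_measurable [measurable] = L2_measurable[OF \<delta>_L2]

text \<open>This is the functional whose Riesz representative is the derivative of \<open>F\<close>.
  Although \<open>\<delta>\<close> is linear only almost surely, integration ignores null sets, so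
  the functional is linear everywhere; Cauchy-Schwarz and the bound on \<open>\<delta>\<close> make
  it bounded.\<close>

lemma bounded_linear_integral_mult_\<delta>:
  assumes F: "F \<in> L2 M"
  shows "bounded_linear (\<lambda>u. \<integral>\<omega>. F \<omega> * \<delta> u \<omega> \<partial>M)"
proof -
  note [measurable] = L2_measurable[OF F]
  note [simp] = L2_integrable_mult[OF F \<delta>_L2]
  obtain K where K: "\<And>h. L2_norm M (\<delta> h) \<le> norm h * K"
    using \<delta>_bounded by blast
  show ?thesis
  proof (rule bounded_linear_intro[where K = "L2_norm M F * K"])
    fix u v
    have "(\<integral>\<omega>. F \<omega> * \<delta> (u + v) \<omega> \<partial>M) = (\<integral>\<omega>. F \<omega> * \<delta> u \<omega> + F \<omega> * \<delta> v \<omega> \<partial>M)"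
      using \<delta>_add[of u v] by (intro integral_cong_AE) (auto simp: distrib_left)
    then show "(\<integral>\<omega>. F \<omega> * \<delta> (u + v) \<omega> \<partial>M) = (\<integral>\<omega>. F \<omega> * \<delta> u \<omega> \<partial>M) + (\<integral>\<omega>. F \<omega> * \<delta> v \<omega> \<partial>M)"
      by simp
  next
    fix c u
    have "(\<integral>\<omega>. F \<omega> * \<delta> (c *\<^sub>R u) \<omega> \<partial>M) = (\<integral>\<omega>. c * (F \<omega> * \<delta> u \<omega>) \<partial>M)"
      using \<delta>_scale[of c u] by (intro integral_cong_AE) auto
    then show "(\<integral>\<omega>. F \<omega> * \<delta> (c *\<^sub>R u) \<omega> \<partial>M) = c *\<^sub>R (\<integral>\<omega>. F \<omega> * \<delta> u \<omega> \<partial>M)"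
      by simp
  next
    fix u
    have "\<bar>\<integral>\<omega>. F \<omega> * \<delta> u \<omega> \<partial>M\<bar> \<le> L2_norm M F * L2_norm M (\<delta> u)"
      by (rule L2_Cauchy_Schwarz[OF F \<delta>_L2])
    also have "\<dots> \<le> L2_norm M F * (norm u * K)"
      by (intro mult_left_mono K) (simp add: L2_norm_def)
    finally show "norm (\<integral>\<omega>. F \<omega> * \<delta> u \<omega> \<partial>M) \<le> norm u * (L2_norm M F * K)"
      by (simp add: mult_ac)
  qed
qed

text \<open>Justifies the definite description in \<open>covariant_derivative\<close>: Riesz gives
  existence, and two representatives differ by a vector orthogonal to itself.\<close>

lemma inner_covariant_derivative:
  assumes "F \<in> L2 M"
  shows "inner (covariant_derivative M \<delta> F) u = (\<integral>\<omega>. F \<omega> * \<delta> u \<omega> \<partial>M)"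
proof -
  obtain h where h: "\<And>u. (\<integral>\<omega>. F \<omega> * \<delta> u \<omega> \<partial>M) = inner h u"
    using riesz_representation[OF bounded_linear_integral_mult_\<delta>[OF assms]] by blast
  have "covariant_derivative M \<delta> F = h"
    unfolding covariant_derivative_def
  proof (rule the_equality)
    fix k
    assume "\<forall>u. (\<integral>\<omega>. F \<omega> * \<delta> u \<omega> \<partial>M) = inner k u"
    then have "inner k u = inner h u" for u
      using h by simp
    then have "inner (k - h) (k - h) = 0"
      by (simp add: inner_diff_left)
    then show "k = h"
      by simp
  qed (use h in blast)
  then show ?thesis
    by (simp add: h)
qed

text \<open>Polarisation: \<open>u + v\<close> stays in \<open>S\<close>, so the isometry holds at
  \<open>u\<close>, \<open>v\<close> and \<open>u + v\<close>, and expanding the square of the sum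
  isolates the cross term.\<close>

lemma integral_\<delta>_mult_\<delta>:
  assumes "subspace S"
    and isometry: "\<And>u. u \<in> S \<Longrightarrow> (\<integral>\<omega>. (\<delta> u \<omega>)\<^sup>2 \<partial>M) = (norm u)\<^sup>2"
    and "u \<in> S" "v \<in> S"
  shows "(\<integral>\<omega>. \<delta> u \<omega> * \<delta> v \<omega> \<partial>M) = inner u v"
proof -
  note [simp] = L2_integrable_mult[OF \<delta>_L2 \<delta>_L2] L2_integrable_square[OF \<delta>_L2]
  have "(norm (u + v))\<^sup>2 = (\<integral>\<omega>. (\<delta> (u + v) \<omega>)\<^sup>2 \<partial>M)"
    using assms by (simp add: subspace_add)
  also have "\<dots> = (\<integral>\<omega>. (\<delta> u \<omega>)\<^sup>2 + (\<delta> v \<omega>)\<^sup>2 + 2 * (\<delta> u \<omega> * \<delta> v \<omega>) \<partial>M)"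
    using \<delta>_add[of u v] by (intro integral_cong_AE) (auto simp: power2_sum)
  also have "\<dots> = (norm u)\<^sup>2 + (norm v)\<^sup>2 + 2 * (\<integral>\<omega>. \<delta> u \<omega> * \<delta> v \<omega> \<partial>M)"
    using assms by simp
  finally show ?thesis
    by (simp add: power2_norm_eq_inner inner_add inner_commute)
qed

end

section \<open>Characterising the orthogonal projection by inner products\<close>

lemma orthogonal_projection_eqI:
  assumes "subspace S" "p \<in> S" and orth: "\<And>u. u \<in> S \<Longrightarrow> inner h u = inner p u"
  shows "orthogonal_projection S h = p"
  unfolding orthogonal_projection_def
proof (rule the_equality)
  show "p \<in> S \<and> h - p \<in> orthogonal_comp S"
    using assms by (simp add: orthogonal_comp_def orthogonal_def inner_diff_right inner_commute)
  fix q
  assume q: "q \<in> S \<and> h - q \<in> orthogonal_comp S"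
  \<comment> \<open>The difference of two candidates lies in \<open>S\<close>, while both residuals
    \<open>h - q\<close> and \<open>h - p\<close> are orthogonal to \<open>S\<close>; hence
    \<open>q - p\<close> is orthogonal to itself.\<close>
  then have "q - p \<in> S"
    using assms by (simp add: subspace_diff)
  then have "inner (q - p) (h - q) = 0" "inner (q - p) (h - p) = 0"
    using q orth[of "q - p"]
    by (auto simp: orthogonal_comp_def orthogonal_def inner_diff_right inner_commute)
  then have "inner (q - p) (q - p) = 0"
    by (simp add: inner_diff_right)
  then show "q = p"
    by simp
qed

section \<open>The projected derivative as the representing integrand\<close>

theorem theorem3p10:
  fixes M :: "'w measure" and T :: real and X :: "real \<Rightarrow> 'w \<Rightarrow> real"
    and V :: "(real \<Rightarrow> 'w \<Rightarrow> real) set"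
    and cls :: "(real \<Rightarrow> 'w \<Rightarrow> real) \<Rightarrow> 'h :: {real_inner, complete_space}"
    and \<delta> :: "'h \<Rightarrow> 'w \<Rightarrow> real"
  defines "\<F> \<equiv> natural_filtration M T X"
  defines "Pred \<equiv> predictable_elements M T \<F> V cls"
  defines "\<Pi>\<^sub>X \<equiv> orthogonal_projection Pred"
  defines "D\<^sub>X \<equiv> covariant_derivative M \<delta>"
  assumes "0 < T"
    and "prob_space M" and "complete_measure M"
    and square_integrable: "\<And>t. t \<in> {0..T} \<Longrightarrow> X t \<in> L2 M"
    and energy: "energy_space M T V cls \<delta>"
    and Pred_closed: "subspace Pred" "closed Pred"
    and centered: "\<And>u. (\<integral>\<omega>. \<delta> u \<omega> \<partial>M) = 0"
    and isometry: "\<And>u. u \<in> Pred \<Longrightarrow> (\<integral>\<omega>. \<bar>\<delta> u \<omega>\<bar>\<^sup>2 \<partial>M) = (norm u)\<^sup>2"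
    and representation:
      "\<And>G. \<lbrakk>G \<in> L2 M \<inter> borel_measurable (\<F> T); (\<integral>\<omega>. G \<omega> \<partial>M) = 0\<rbrakk>
         \<Longrightarrow> \<exists>v\<in>Pred. AE \<omega> in M. G \<omega> = \<delta> v \<omega>"
  shows "(\<forall>F \<in> L2 M \<inter> borel_measurable (\<F> T).
            AE \<omega> in M. F \<omega> = (\<integral>\<omega>'. F \<omega>' \<partial>M) + \<delta> (\<Pi>\<^sub>X (D\<^sub>X F)) \<omega>) \<and>
         (\<forall>F \<in> L2 M \<inter> borel_measurable (\<F> T).
            AE \<omega> in M. F \<omega> - (\<integral>\<omega>'. F \<omega>' \<partial>M) = (\<delta> \<circ> \<Pi>\<^sub>X \<circ> D\<^sub>X) F \<omega>)"
proof -
  interpret prob_space M by fact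
  interpret energy_space M T V cls \<delta> by fact
  have main: "AE \<omega> in M. F \<omega> - (\<integral>\<omega>'. F \<omega>' \<partial>M) = \<delta> (\<Pi>\<^sub>X (D\<^sub>X F)) \<omega>"
    if F: "F \<in> L2 M" and F_meas: "F \<in> borel_measurable (\<F> T)" for F
  proof -
    define c where "c = (\<integral>\<omega>. F \<omega> \<partial>M)"
    define G where "G \<omega> = F \<omega> - c" for \<omega>
    note [measurable] = L2_measurable[OF F]
    note [simp] = L2_integrable_square[OF F]
    \<comment> \<open>On a probability space square integrability implies integrability.\<close>
    have [simp]: "integrable M F"
      by (rule square_integrable_imp_integrable) simp_all
    have G_L2: "G \<in> L2 M"
      unfolding L2_def G_def by (simp add: power2_diff)
    have "G \<in> borel_measurable (\<F> T)"
      unfolding G_def using F_meas by measurable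
    moreover have "(\<integral>\<omega>. G \<omega> \<partial>M) = 0"
      by (simp add: G_def c_def prob_space)
    ultimately obtain v where v: "v \<in> Pred" and Gv: "AE \<omega> in M. G \<omega> = \<delta> v \<omega>"
      using representation[of G] G_L2 by blast
    have "inner (D\<^sub>X F) u = inner v u" if u: "u \<in> Pred" for u
    proof -
      have \<delta>_integrable: "integrable M (\<delta> u)"
        by (rule square_integrable_imp_integrable) (simp_all add: L2_integrable_square[OF \<delta>_L2])
      have "inner (D\<^sub>X F) u = (\<integral>\<omega>. F \<omega> * \<delta> u \<omega> \<partial>M)"
        unfolding D\<^sub>X_def by (rule inner_covariant_derivative[OF F])
      also have "\<dots> = (\<integral>\<omega>. G \<omega> * \<delta> u \<omega> + c * \<delta> u \<omega> \<partial>M)"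
        by (simp add: G_def algebra_simps)
      also have "\<dots> = (\<integral>\<omega>. G \<omega> * \<delta> u \<omega> \<partial>M)"
        using centered[of u] \<delta>_integrable L2_integrable_mult[OF G_L2 \<delta>_L2[of u]] by simp
      also have "\<dots> = (\<integral>\<omega>. \<delta> v \<omega> * \<delta> u \<omega> \<partial>M)"
        using Gv L2_measurable[OF G_L2] by (intro integral_cong_AE) auto
      also have "\<dots> = inner v u"
        using isometry by (intro integral_\<delta>_mult_\<delta>[OF Pred_closed(1) _ v u]) simp
      finally show ?thesis .
    qed
    \<comment> \<open>\<open>v\<close> is predictable and has the same inner products as
      \<open>D\<^sub>X F\<close> with all predictable elements, so it is the projection; applying
      \<open>\<delta>\<close> then recovers \<open>G\<close> almost surely.\<close>
    then have "\<Pi>\<^sub>X (D\<^sub>X F) = v"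
      unfolding \<Pi>\<^sub>X_def by (rule orthogonal_projection_eqI[OF Pred_closed(1) v])
    with Gv show ?thesis
      by (simp add: G_def c_def)
  qed
  show ?thesis
  proof (intro conjI ballI)
    fix F
    assume "F \<in> L2 M \<inter> borel_measurable (\<F> T)"
    then have *: "AE \<omega> in M. F \<omega> - (\<integral>\<omega>'. F \<omega>' \<partial>M) = \<delta> (\<Pi>\<^sub>X (D\<^sub>X F)) \<omega>"
      using main by blast
    then show "AE \<omega> in M. F \<omega> - (\<integral>\<omega>'. F \<omega>' \<partial>M) = (\<delta> \<circ> \<Pi>\<^sub>X \<circ> D\<^sub>X) F \<omega>"
      by simp
    from * show "AE \<omega> in M. F \<omega> = (\<integral>\<omega>'. F \<omega>' \<partial>M) + \<delta> (\<Pi>\<^sub>X (D\<^sub>X F)) \<omega>"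
      by eventually_elim simp
  qed
qed

end
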